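(* $H^1_{2s}$ is a proper subspace of $H^A$, and is continuously included in $H^1$: $H^1_{2s}\subset H^A$, the inclusion map $H^1_{2s}\to H^1$ is continuous, and there exists $f\in H^A$ with $f\notin H^1_{2s}$.
   Context: All functions are on $\mathbb{R}$. An atom with defining interval $I$ (a bounded interval) is a function $a$ with $\operatorname{supp}(a)\subseteq I$, $|a(x)|\le 1/|I|$ and $\int_I a(x)\,dx=0$. $H^1=H^1(\mathbb{R})$ is the Banach space of all $f=\sum_{j=1}^\infty\lambda_j a_j$ (convergence in $L^1$ and in the sense of distributions) with $a_j$ atoms and $\sum_j|\lambda_j|<\infty$, normed by $\|f\|_{H^1}=\inf\sum_j|\lambda_j|$ over all such decompositions. $H^A=\{f\in H^1:\int_0^{\infty}f(x)\,dx=0\}$. $H^1_{2s}$ (two-sided $H^1$) is defined in the same way as $H^1$, with its own atomic norm $\|\cdot\|_{H^1_{2s}}$, but using only atoms whose defining interval lies on one side of the origin, i.e. is contained in $(-\infty,0]$ or in $[0,\infty)$. *)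

theory Defs
  imports "HOL-Analysis.Analysis" "HOL-Library.Function_Algebras"
begin

text \<open>
  The scalar type \<open>'a\<close> ranges over a sort that contains both \<^typ>\<open>real\<close> and \<^typ>\<open>complex\<close>, so
  that real-valued and complex-valued functions are treated at once.

  Elements of the spaces below are functions rather than classes modulo null sets; each of the
  spaces is closed under almost-everywhere equality, and the "norms" are seminorms that identify
  exactly the almost-everywhere equal functions.
\<close>

definition atom_on :: "real set \<Rightarrow> (real \<Rightarrow> 'a::{real_normed_field,banach,second_countable_topology}) \<Rightarrow> bool"
  where "atom_on I a \<longleftrightarrow>
    is_interval I \<and> bounded I \<and> 0 < measure lebesgue I \<and>
    a \<in> borel_measurable lebesgue \<and>
    closure {x. a x \<noteq> 0} \<subseteq> I \<and>
    (\<forall>x. norm (a x) \<le> 1 / measure lebesgue I) \<and>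
    (LINT x:I|lebesgue. a x) = 0"

definition test_function :: "(real \<Rightarrow> real) \<Rightarrow> bool"
  where "test_function \<phi> \<longleftrightarrow>
    (\<forall>k x. (deriv ^^ k) \<phi> field_differentiable at x) \<and> compact (closure {x. \<phi> x \<noteq> 0})"

text \<open>Real-valued test functions suffice to express convergence of complex distributions.\<close>

definition distributional_limit ::
    "(nat \<Rightarrow> real \<Rightarrow> 'a::{real_normed_field,banach,second_countable_topology}) \<Rightarrow> (real \<Rightarrow> 'a) \<Rightarrow> bool"
  where "distributional_limit s f \<longleftrightarrow>
    (\<forall>\<phi>. test_function \<phi> \<longrightarrow>
      (\<lambda>n. LINT x|lebesgue. \<phi> x *\<^sub>R s n x) \<longlonglongrightarrow> (LINT x|lebesgue. \<phi> x *\<^sub>R f x))"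

definition L1_limit ::
    "(nat \<Rightarrow> real \<Rightarrow> 'a::{real_normed_field,banach,second_countable_topology}) \<Rightarrow> (real \<Rightarrow> 'a) \<Rightarrow> bool"
  where "L1_limit s f \<longleftrightarrow>
    (\<forall>n. integrable lebesgue (s n)) \<and> integrable lebesgue f \<and>
    (\<lambda>n. LINT x|lebesgue. norm (s n x - f x)) \<longlonglongrightarrow> 0"

text \<open>\<open>\<I>\<close> is the family of admissible defining intervals.\<close>

definition atomic_decomposition ::
    "real set set \<Rightarrow> (real \<Rightarrow> 'a::{real_normed_field,banach,second_countable_topology}) \<Rightarrow>
     (nat \<Rightarrow> 'a) \<Rightarrow> (nat \<Rightarrow> real \<Rightarrow> 'a) \<Rightarrow> bool"
  where "atomic_decomposition \<I> f c a \<longleftrightarrow>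
    (\<forall>j. \<exists>I\<in>\<I>. atom_on I (a j)) \<and>
    summable (\<lambda>j. norm (c j)) \<and>
    L1_limit (\<lambda>n x. \<Sum>j<n. c j * a j x) f \<and>
    distributional_limit (\<lambda>n x. \<Sum>j<n. c j * a j x) f"

definition atomic_space ::
    "real set set \<Rightarrow> (real \<Rightarrow> 'a::{real_normed_field,banach,second_countable_topology}) set"
  where "atomic_space \<I> = {f. \<exists>c a. atomic_decomposition \<I> f c a}"

definition atomic_norm ::
    "real set set \<Rightarrow> (real \<Rightarrow> 'a::{real_normed_field,banach,second_countable_topology}) \<Rightarrow> real"
  where "atomic_norm \<I> f = Inf {\<Sum>j. norm (c j) | c a. atomic_decomposition \<I> f c a}"

definition one_sided_sets :: "real set set"
  where "one_sided_sets = {I. I \<subseteq> {..0} \<or> I \<subseteq> {0..}}"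

definition H1 :: "(real \<Rightarrow> 'a::{real_normed_field,banach,second_countable_topology}) set"
  where "H1 = atomic_space UNIV"

definition H1_norm :: "(real \<Rightarrow> 'a::{real_normed_field,banach,second_countable_topology}) \<Rightarrow> real"
  where "H1_norm = atomic_norm UNIV"

definition H1_2s :: "(real \<Rightarrow> 'a::{real_normed_field,banach,second_countable_topology}) set"
  where "H1_2s = atomic_space one_sided_sets"

definition H1_2s_norm :: "(real \<Rightarrow> 'a::{real_normed_field,banach,second_countable_topology}) \<Rightarrow> real"
  where "H1_2s_norm = atomic_norm one_sided_sets"

definition HA :: "(real \<Rightarrow> 'a::{real_normed_field,banach,second_countable_topology}) set"
  where "HA = {f \<in> H1. (LINT x:{0..}|lebesgue. f x) = 0}"

text \<open>
  The topology of a (semi)normed space of functions with carrier \<open>S\<close> and (semi)norm \<open>N\<close>.  The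
  library's metric topologies do not apply directly, since almost-everywhere equal functions
  are at distance 0.
\<close>

definition norm_topology :: "('b::ab_group_add) set \<Rightarrow> ('b \<Rightarrow> real) \<Rightarrow> 'b topology"
  where "norm_topology S N =
    topology (\<lambda>U. U \<subseteq> S \<and> (\<forall>f\<in>U. \<exists>e>0. \<forall>g\<in>S. N (g - f) < e \<longrightarrow> g \<in> U))"

lemma istopology_norm_topology:
  "istopology (\<lambda>U. U \<subseteq> S \<and> (\<forall>f\<in>U. \<exists>e>0. \<forall>g\<in>S. N (g - f) < (e::real) \<longrightarrow> g \<in> U))"
  unfolding istopology_def
proof (intro conjI allI impI)
  fix U V
  assume U: "U \<subseteq> S \<and> (\<forall>f\<in>U. \<exists>e>0. \<forall>g\<in>S. N (g - f) < e \<longrightarrow> g \<in> U)"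
    and V: "V \<subseteq> S \<and> (\<forall>f\<in>V. \<exists>e>0. \<forall>g\<in>S. N (g - f) < e \<longrightarrow> g \<in> V)"
  show "U \<inter> V \<subseteq> S" using U by blast
  show "\<forall>f\<in>U \<inter> V. \<exists>e>0. \<forall>g\<in>S. N (g - f) < e \<longrightarrow> g \<in> U \<inter> V"
  proof
    fix f assume "f \<in> U \<inter> V"
    then obtain d e where "d > 0" "e > 0" "\<forall>g\<in>S. N (g - f) < d \<longrightarrow> g \<in> U"
      "\<forall>g\<in>S. N (g - f) < e \<longrightarrow> g \<in> V"
      using U V by blast
    then show "\<exists>e>0. \<forall>g\<in>S. N (g - f) < e \<longrightarrow> g \<in> U \<inter> V"
      by (intro exI[of _ "min d e"]) auto
  qed
next
  fix \<U>
  assume *: "\<forall>U\<in>\<U>. U \<subseteq> S \<and> (\<forall>f\<in>U. \<exists>e>0. \<forall>g\<in>S. N (g - f) < e \<longrightarrow> g \<in> U)"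
  then show "\<Union>\<U> \<subseteq> S" by blast
  show "\<forall>f\<in>\<Union>\<U>. \<exists>e>0. \<forall>g\<in>S. N (g - f) < e \<longrightarrow> g \<in> \<Union>\<U>"
  proof
    fix f assume "f \<in> \<Union>\<U>"
    then obtain U where U: "U \<in> \<U>" "f \<in> U" by blast
    with * obtain e where "e > 0" "\<forall>g\<in>S. N (g - f) < e \<longrightarrow> g \<in> U" by blast
    with U show "\<exists>e>0. \<forall>g\<in>S. N (g - f) < e \<longrightarrow> g \<in> \<Union>\<U>" by blast
  qed
qed

lemma openin_norm_topology:
  "openin (norm_topology S N) U \<longleftrightarrow>
    U \<subseteq> S \<and> (\<forall>f\<in>U. \<exists>e>0. \<forall>g\<in>S. N (g - f) < e \<longrightarrow> g \<in> U)"
  unfolding norm_topology_def topology_inverse'[OF istopology_norm_topology] ..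

lemma topspace_norm_topology: "topspace (norm_topology S N) = S"
proof
  show "topspace (norm_topology S N) \<subseteq> S"
    using openin_topspace[of "norm_topology S N"] unfolding openin_norm_topology by blast
  have "openin (norm_topology S N) S"
    unfolding openin_norm_topology by (auto intro: exI[of _ 1])
  then show "S \<subseteq> topspace (norm_topology S N)" by (rule openin_subset)
qed

definition function_scale :: "'a::field \<Rightarrow> ('b \<Rightarrow> 'a) \<Rightarrow> 'b \<Rightarrow> 'a"
  where "function_scale c f = (\<lambda>x. c * f x)"

lemma module_function_scale: "module function_scale"
  by unfold_locales (simp_all add: function_scale_def fun_eq_iff algebra_simps)

end

theory Submission imports Defs begin

text \<open>
  Integration against a bounded measurable weight \<open>g\<close> is continuous for \<open>L\<^sup>1\<close>-convergence, so
  \<open>\<integral> g f = (\<Sum>j. c\<^sub>j \<integral> g a\<^sub>j)\<close> for every atomic decomposition of \<open>f\<close>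
  (\<open>decomposition_weighted_sums\<close>).

  With \<open>g\<close> the indicator of \<open>[0, \<infinity>)\<close> each one-sided atom contributes \<open>0\<close>, which gives
  \<open>H1_2s \<subseteq> HA\<close>.  Interleaving two decompositions shows that \<open>H1_2s\<close> is a subspace.  A one-sided
  decomposition is in particular a decomposition, so \<open>H1_norm \<le> H1_2s_norm\<close> on \<open>H1_2s\<close>, and the
  inclusion is continuous.

  The inclusion \<open>H1_2s \<subseteq> HA\<close> is strict because the logarithm on the half line \<open>[0, \<infinity>)\<close>, extended
  by \<open>0\<close>, has bounded mean oscillation over one-sided intervals but not over all intervals.  The
  bounded weights \<open>ln (x + \<epsilon>) - ln (x + 1)\<close> on \<open>[0, \<infinity>)\<close> have mean oscillation at most \<open>1\<close>
  there, uniformly in \<open>\<epsilon>\<close>.  Hence their integrals against one-sided atoms are bounded by \<open>1\<close>, and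
  those against a fixed \<open>f \<in> H1_2s\<close> stay bounded as \<open>\<epsilon> \<rightarrow> 0\<close> (\<open>H1_2s_log_weight_bounded\<close>).

  On the other hand the odd atom \<open>sgn x / (2 h)\<close> on \<open>[-h, h]\<close> has integral \<open>1 / 2\<close> over
  \<open>[0, \<infinity>)\<close> and its integral against the weight is about \<open>ln h / 2\<close> for \<open>\<epsilon> \<le> h\<close>.  With widths
  \<open>h\<^sub>j = exp (- (2 ^ j)) / 2\<close> and coefficients \<open>-1, 1/2, 1/4, \<dots>\<close> of total sum \<open>0\<close>, the
  resulting series lies in \<open>HA\<close>, while every term with \<open>1 \<le> j \<le> n\<close> contributes at most \<open>- 1 / 2\<close> to
  the integral against the weight with \<open>\<epsilon> = h\<^sub>n\<close>.  These integrals are therefore unbounded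
  (\<open>lacunary_function_log_weight_lower_bound\<close>), and the series is not in \<open>H1_2s\<close>.
\<close>

section \<open>Atoms and integrals against bounded weights\<close>

lemma integrable_bounded_scaleR:
  fixes f :: "real \<Rightarrow> 'a::{real_normed_field,banach,second_countable_topology}"
  assumes "integrable lebesgue f" "g \<in> borel_measurable lebesgue" "\<And>x. \<bar>g x\<bar> \<le> B"
  shows "integrable lebesgue (\<lambda>x. g x *\<^sub>R f x)"
proof (rule Bochner_Integration.integrable_bound)
  show "integrable lebesgue (\<lambda>x. B *\<^sub>R f x)" using assms by simp
  show "(\<lambda>x. g x *\<^sub>R f x) \<in> borel_measurable lebesgue" using assms by measurable
  have "\<bar>g x\<bar> \<le> \<bar>B\<bar>" for x using assms(3)[of x] by linarith
  then show "AE x in lebesgue. norm (g x *\<^sub>R f x) \<le> norm (B *\<^sub>R f x)"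
    by (simp add: mult_right_mono)
qed

lemma L1_limit_weighted:
  fixes f :: "real \<Rightarrow> 'a::{real_normed_field,banach,second_countable_topology}"
  assumes "L1_limit s f" "g \<in> borel_measurable lebesgue" "\<And>x. \<bar>g x\<bar> \<le> B"
  shows "(\<lambda>n. LINT x|lebesgue. g x *\<^sub>R s n x) \<longlonglongrightarrow> (LINT x|lebesgue. g x *\<^sub>R f x)"
proof -
  have s: "integrable lebesgue (s n)" and f: "integrable lebesgue f"
    and lim: "(\<lambda>n. LINT x|lebesgue. norm (s n x - f x)) \<longlonglongrightarrow> 0" for n
    using assms(1) by (auto simp: L1_limit_def)
  note gs = integrable_bounded_scaleR[OF s assms(2,3)]
  note gf = integrable_bounded_scaleR[OF f assms(2,3)]
  have "norm ((LINT x|lebesgue. g x *\<^sub>R s n x) - (LINT x|lebesgue. g x *\<^sub>R f x))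
      \<le> B * (LINT x|lebesgue. norm (s n x - f x))" for n
  proof -
    have "(LINT x|lebesgue. g x *\<^sub>R s n x) - (LINT x|lebesgue. g x *\<^sub>R f x)
        = (LINT x|lebesgue. g x *\<^sub>R s n x - g x *\<^sub>R f x)"
      by (rule Bochner_Integration.integral_diff[symmetric, OF gs gf])
    also have "norm \<dots> \<le> (LINT x|lebesgue. B * norm (s n x - f x))"
    proof (rule Bochner_Integration.integral_norm_bound_integral)
      show "integrable lebesgue (\<lambda>x. g x *\<^sub>R s n x - g x *\<^sub>R f x)" using gs gf by simp
      show "integrable lebesgue (\<lambda>x. B * norm (s n x - f x))" using s f by simp
      show "norm (g x *\<^sub>R s n x - g x *\<^sub>R f x) \<le> B * norm (s n x - f x)" for x
        unfolding scaleR_diff_right[symmetric] norm_scaleR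
        by (intro mult_right_mono assms) simp
    qed
    finally show ?thesis by simp
  qed
  moreover have "(\<lambda>n. B * (LINT x|lebesgue. norm (s n x - f x))) \<longlonglongrightarrow> 0"
    using tendsto_mult_right_zero[OF lim] by simp
  ultimately show ?thesis
    by (subst LIM_zero_iff[symmetric]) (rule Lim_null_comparison[OF always_eventually], auto)
qed

lemma test_function_bounded:
  assumes "test_function \<phi>"
  shows "\<phi> \<in> borel_measurable lebesgue" and "\<exists>B. \<forall>x. \<bar>\<phi> x\<bar> \<le> B"
proof -
  have "\<phi> field_differentiable at x" for x
    using assms[unfolded test_function_def] by (metis funpow_0)
  then have cont: "continuous_on UNIV \<phi>"
    by (simp add: continuous_at_imp_continuous_on field_differentiable_imp_continuous_at)
  then show "\<phi> \<in> borel_measurable lebesgue"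
    by (intro measurable_completion) (simp add: borel_measurable_continuous_onI)
  obtain B where "\<And>y. y \<in> \<phi> ` closure {x. \<phi> x \<noteq> 0} \<Longrightarrow> norm y \<le> B"
    using compact_imp_bounded[OF compact_continuous_image[OF continuous_on_subset[OF cont]]] assms
    unfolding test_function_def bounded_iff by (metis subset_UNIV)
  then have B: "\<bar>\<phi> x\<bar> \<le> B" if "\<phi> x \<noteq> 0" for x
    using that closure_subset[of "{x. \<phi> x \<noteq> 0}"]
    by (metis (mono_tags) imageI mem_Collect_eq real_norm_def subsetD)
  have "\<bar>\<phi> x\<bar> \<le> max B 0" for x
    using B[of x] by (cases "\<phi> x = 0") simp_all
  then show "\<exists>B. \<forall>x. \<bar>\<phi> x\<bar> \<le> B" by blast
qed

lemma L1_limit_imp_distributional_limit: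
  assumes "L1_limit s f"
  shows "distributional_limit s f"
  unfolding distributional_limit_def
proof (intro allI impI)
  fix \<phi> assume \<phi>: "test_function \<phi>"
  obtain B where "\<And>x. \<bar>\<phi> x\<bar> \<le> B"
    using test_function_bounded(2)[OF \<phi>] by blast
  then show "(\<lambda>n. LINT x|lebesgue. \<phi> x *\<^sub>R s n x) \<longlonglongrightarrow> (LINT x|lebesgue. \<phi> x *\<^sub>R f x)"
    by (rule L1_limit_weighted[OF assms test_function_bounded(1)[OF \<phi>]])
qed

text \<open>The distributional convergence in an atomic decomposition is implied by the \<open>L\<^sup>1\<close>-convergence.\<close>

lemma atomic_decomposition_iff:
  "atomic_decomposition \<I> f c a \<longleftrightarrow>
    (\<forall>j. \<exists>I\<in>\<I>. atom_on I (a j)) \<and> summable (\<lambda>j. norm (c j)) \<and>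
    L1_limit (\<lambda>n x. \<Sum>j<n. c j * a j x) f"
  using L1_limit_imp_distributional_limit[of "\<lambda>n x. \<Sum>j<n. c j * a j x" f]
  unfolding atomic_decomposition_def by iprover

lemma atom_on_support: "atom_on I a \<Longrightarrow> x \<notin> I \<Longrightarrow> a x = 0"
  using closure_subset[of "{x. a x \<noteq> 0}"] unfolding atom_on_def by blast

text \<open>
  The defining interval may be open, closed or half-open; only its compact hull and a lower bound
  for its length are needed.
\<close>

lemma atom_on_hull:
  assumes "atom_on I a"
  obtains p q where "p \<le> q" "I \<subseteq> {p..q}" "q - p \<le> measure lebesgue I"
    "I \<subseteq> {0..} \<Longrightarrow> 0 \<le> p"
proof -
  have I: "is_interval I" "bounded I" "0 < measure lebesgue I"
    using assms by (auto simp: atom_on_def)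
  then have ne: "I \<noteq> {}" by auto
  have bd: "bdd_above I" "bdd_below I"
    using I(2) by (auto simp: bounded_imp_bdd_above bounded_imp_bdd_below)
  have sub: "I \<subseteq> {Inf I..Sup I}"
    using bd by (auto intro: cInf_lower cSup_upper)
  have "{Inf I<..<Sup I} \<subseteq> I"
  proof
    fix x assume "x \<in> {Inf I<..<Sup I}"
    then obtain u v where "u \<in> I" "u < x" "v \<in> I" "x < v"
      using ne bd by (auto simp: cInf_less_iff less_cSup_iff)
    then show "x \<in> I"
      using I(1) by (meson is_interval_1 less_imp_le)
  qed
  moreover have "I \<in> lmeasurable"
    using I real_interval_borel_measurable by (intro bounded_set_imp_lmeasurable) auto
  ultimately have "measure lebesgue {Inf I<..<Sup I} \<le> measure lebesgue I"
    by (intro measure_mono_fmeasurable) auto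
  moreover have "Inf I \<le> Sup I" using sub ne by fastforce
  moreover have "I \<subseteq> {0..} \<Longrightarrow> 0 \<le> Inf I" using ne by (intro cInf_greatest) auto
  ultimately show ?thesis using sub by (intro that[of "Inf I" "Sup I"]) auto
qed

lemma atom_on_integrable:
  fixes a :: "real \<Rightarrow> 'a::{real_normed_field,banach,second_countable_topology}"
  assumes "atom_on I a"
  shows "integrable lebesgue a"
proof -
  obtain p q where "p \<le> q" "I \<subseteq> {p..q}" using atom_on_hull[OF assms] by metis
  then have "a x = 0" if "x \<notin> {p..q}" for x
    using that atom_on_support[OF assms] by blast
  then show ?thesis
    using assms \<open>p \<le> q\<close> unfolding atom_on_def
    by (intro integrableI_bounded_set[where A="{p..q}" and B="1 / measure lebesgue I"])
       (auto simp: emeasure_lborel_Icc)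
qed

lemma atom_on_integral:
  assumes "atom_on I a"
  shows "(LINT x|lebesgue. a x) = 0"
proof -
  have "(LINT x:I|lebesgue. a x) = (LINT x|lebesgue. a x)"
    unfolding set_lebesgue_integral_def
    by (intro Bochner_Integration.integral_cong)
       (use atom_on_support[OF assms] in \<open>auto simp: indicator_def\<close>)
  then show ?thesis using assms by (simp add: atom_on_def)
qed

text \<open>The weight is arbitrary at the origin, which is a null set.\<close>

lemma atom_on_left_half_line:
  assumes "atom_on I a" "I \<subseteq> {..0}" "\<And>x. x < 0 \<Longrightarrow> g x = 0"
  shows "(LINT x|lebesgue. g x *\<^sub>R a x) = 0"
proof -
  have "AE x in lebesgue. x \<noteq> (0::real)"
    by (rule AE_completion) (rule AE_lborel_singleton)
  moreover have "g x *\<^sub>R a x = 0" if "x \<noteq> 0" for x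
  proof (cases "x < 0")
    case False
    then have "a x = 0" using atom_on_support[OF assms(1)] assms(2) that by force
    then show ?thesis by simp
  qed (simp add: assms(3))
  ultimately have "AE x in lebesgue. g x *\<^sub>R a x = 0" by auto
  then show ?thesis by (rule integral_eq_zero_AE)
qed

lemma decomposition_weighted_sums:
  fixes f :: "real \<Rightarrow> 'a::{real_normed_field,banach,second_countable_topology}"
  assumes "atomic_decomposition \<I> f c a" "g \<in> borel_measurable lebesgue" "\<And>x. \<bar>g x\<bar> \<le> B"
  shows "(\<lambda>j. c j * (LINT x|lebesgue. g x *\<^sub>R a j x)) sums (LINT x|lebesgue. g x *\<^sub>R f x)"
proof -
  have at: "integrable lebesgue (a j)" for j
    using assms(1) atom_on_integrable by (metis atomic_decomposition_def)
  have "(LINT x|lebesgue. g x *\<^sub>R (\<Sum>j<n. c j * a j x))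
      = (\<Sum>j<n. c j * (LINT x|lebesgue. g x *\<^sub>R a j x))" for n
  proof -
    have "(LINT x|lebesgue. g x *\<^sub>R (\<Sum>j<n. c j * a j x))
        = (LINT x|lebesgue. (\<Sum>j<n. c j * (g x *\<^sub>R a j x)))"
      by (simp add: scaleR_sum_right)
    also have "\<dots> = (\<Sum>j<n. LINT x|lebesgue. c j * (g x *\<^sub>R a j x))"
      by (intro Bochner_Integration.integral_sum integrable_mult_right
            integrable_bounded_scaleR[OF at assms(2,3)])
    finally show ?thesis by (simp del: mult_scaleR_right)
  qed
  with L1_limit_weighted[OF _ assms(2,3)] assms(1) show ?thesis
    unfolding sums_def atomic_decomposition_def by fastforce
qed

section \<open>The two-sided space inside the mean-zero space\<close>

lemma indicator_half_line_measurable: "indicat_real {0::real..} \<in> borel_measurable lebesgue"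
  by (intro borel_measurable_indicator) simp

lemma H1_2s_subset_H1: "H1_2s \<subseteq> H1"
  unfolding H1_2s_def H1_def atomic_space_def atomic_decomposition_def by blast

lemma H1_2s_subset_HA:
  "(H1_2s :: (real \<Rightarrow> 'a::{real_normed_field,banach,second_countable_topology}) set) \<subseteq> HA"
proof
  fix f :: "real \<Rightarrow> 'a" assume f: "f \<in> H1_2s"
  then obtain c a where ca: "atomic_decomposition one_sided_sets f c a"
    by (auto simp: H1_2s_def atomic_space_def)
  have "(LINT x|lebesgue. indicat_real {0..} x *\<^sub>R a j x) = 0" for j
  proof -
    obtain I where I: "I \<subseteq> {..0} \<or> I \<subseteq> {0..}" "atom_on I (a j)"
      using ca unfolding atomic_decomposition_def one_sided_sets_def by blast
    from I(1) show ?thesis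
    proof
      assume "I \<subseteq> {..0}"
      then show ?thesis by (rule atom_on_left_half_line[OF I(2)]) simp
    next
      assume "I \<subseteq> {0..}"
      then have "(LINT x|lebesgue. indicat_real {0..} x *\<^sub>R a j x) = (LINT x|lebesgue. a j x)"
        by (intro Bochner_Integration.integral_cong)
           (use atom_on_support[OF I(2)] in \<open>auto simp: indicator_def\<close>)
      then show ?thesis using atom_on_integral[OF I(2)] by simp
    qed
  qed
  then have "(\<lambda>j. 0) sums (LINT x|lebesgue. indicat_real {0..} x *\<^sub>R f x)"
    using decomposition_weighted_sums[OF ca indicator_half_line_measurable, of 1] by simp
  then have "(LINT x:{0..}|lebesgue. f x) = 0"
    unfolding set_lebesgue_integral_def by (simp add: sums_iff)
  then show "f \<in> HA" using f H1_2s_subset_H1 unfolding HA_def by blast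
qed

section \<open>Subspace property and continuity of the inclusion\<close>

lemma sum_interleave:
  fixes u v :: "nat \<Rightarrow> 'b::comm_monoid_add"
  shows "(\<Sum>j<n. if even j then u (j div 2) else v (j div 2))
    = (\<Sum>j<(n + 1) div 2. u j) + (\<Sum>j<n div 2. v j)"
proof (induction n)
  case (Suc n)
  show ?case
  proof (cases "even n")
    case True
    then have "(Suc n + 1) div 2 = Suc (n div 2)" "(n + 1) div 2 = n div 2" "Suc n div 2 = n div 2"
      by presburger+
    with Suc True show ?thesis by (simp add: ac_simps)
  next
    case False
    then have "(Suc n + 1) div 2 = (n + 1) div 2" "Suc n div 2 = Suc (n div 2)"
      by presburger+
    with Suc False show ?thesis by (simp add: ac_simps)
  qed
qed simp


lemma half_at_top:
  "filterlim (\<lambda>n::nat. (n + 1) div 2) at_top at_top" "filterlim (\<lambda>n::nat. n div 2) at_top at_top"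
proof -
  have "Z \<le> (n + 1) div 2" "Z \<le> n div 2" if "2 * Z \<le> n" for Z n :: nat
    using that by linarith+
  then show "filterlim (\<lambda>n::nat. (n + 1) div 2) at_top at_top"
      "filterlim (\<lambda>n::nat. n div 2) at_top at_top"
    unfolding filterlim_at_top eventually_sequentially by blast+
qed

lemma sums_interleave:
  fixes u v :: "nat \<Rightarrow> 'b::real_normed_vector"
  assumes "u sums x" "v sums y"
  shows "(\<lambda>j. if even j then u (j div 2) else v (j div 2)) sums (x + y)"
  unfolding sums_def sum_interleave
  by (intro tendsto_add filterlim_compose[OF assms(1)[unfolded sums_def] half_at_top(1)]
        filterlim_compose[OF assms(2)[unfolded sums_def] half_at_top(2)])

lemma atomic_decomposition_add:
  fixes f g :: "real \<Rightarrow> 'a::{real_normed_field,banach,second_countable_topology}"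
  assumes f: "atomic_decomposition \<I> f c a" and g: "atomic_decomposition \<I> g d b"
  shows "atomic_decomposition \<I> (\<lambda>x. f x + g x)
    (\<lambda>j. if even j then c (j div 2) else d (j div 2))
    (\<lambda>j. if even j then a (j div 2) else b (j div 2))"
    (is "atomic_decomposition \<I> _ ?e ?t")
proof -
  define s where "s n x = (\<Sum>j<n. c j * a j x)" for n x
  define r where "r n x = (\<Sum>j<n. d j * b j x)" for n x
  have s: "integrable lebesgue (s n)" "integrable lebesgue f"
      "(\<lambda>n. LINT x|lebesgue. norm (s n x - f x)) \<longlonglongrightarrow> 0"
    and r: "integrable lebesgue (r n)" "integrable lebesgue g"
      "(\<lambda>n. LINT x|lebesgue. norm (r n x - g x)) \<longlonglongrightarrow> 0" for n
    using f g unfolding atomic_decomposition_def L1_limit_def s_def r_def by auto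
  have split: "(\<Sum>j<n. ?e j * ?t j x) = s ((n + 1) div 2) x + r (n div 2) x" for n x
  proof -
    have "(\<Sum>j<n. ?e j * ?t j x)
        = (\<Sum>j<n. if even j then c (j div 2) * a (j div 2) x else d (j div 2) * b (j div 2) x)"
      by (intro sum.cong) auto
    then show ?thesis
      unfolding s_def r_def
      by (simp only: sum_interleave[where u="\<lambda>j. c j * a j x" and v="\<lambda>j. d j * b j x"])
  qed
  have "L1_limit (\<lambda>n x. \<Sum>j<n. ?e j * ?t j x) (\<lambda>x. f x + g x)"
    unfolding L1_limit_def split
  proof (intro conjI allI)
    show "integrable lebesgue (\<lambda>x. s ((n + 1) div 2) x + r (n div 2) x)" for n
      using s r by simp
    show "integrable lebesgue (\<lambda>x. f x + g x)" using s r by simp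
    have lim: "(\<lambda>n. (LINT x|lebesgue. norm (s ((n + 1) div 2) x - f x))
        + (LINT x|lebesgue. norm (r (n div 2) x - g x))) \<longlonglongrightarrow> 0 + 0"
      by (intro tendsto_add filterlim_compose[OF s(3) half_at_top(1)]
            filterlim_compose[OF r(3) half_at_top(2)])
    have le: "(LINT x|lebesgue. norm (s ((n + 1) div 2) x + r (n div 2) x - (f x + g x)))
      \<le> (LINT x|lebesgue. norm (s ((n + 1) div 2) x - f x))
        + (LINT x|lebesgue. norm (r (n div 2) x - g x))" for n
    proof -
      have "(LINT x|lebesgue. norm (s ((n + 1) div 2) x + r (n div 2) x - (f x + g x)))
        \<le> (LINT x|lebesgue. norm (s ((n + 1) div 2) x - f x) + norm (r (n div 2) x - g x))"
        using s r by (intro integral_mono) (auto intro: norm_diff_triangle_ineq)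
      then show ?thesis using s r by simp
    qed
    show "(\<lambda>n. LINT x|lebesgue.
        norm (s ((n + 1) div 2) x + r (n div 2) x - (f x + g x))) \<longlonglongrightarrow> 0"
    proof (rule Lim_null_comparison)
      show "(\<lambda>n. (LINT x|lebesgue. norm (s ((n + 1) div 2) x - f x))
        + (LINT x|lebesgue. norm (r (n div 2) x - g x))) \<longlonglongrightarrow> 0"
        using lim by simp
      show "\<forall>\<^sub>F n in sequentially.
        norm (LINT x|lebesgue. norm (s ((n + 1) div 2) x + r (n div 2) x - (f x + g x)))
        \<le> (LINT x|lebesgue. norm (s ((n + 1) div 2) x - f x))
          + (LINT x|lebesgue. norm (r (n div 2) x - g x))"
        using le by (intro always_eventually allI) (simp add: integral_nonneg_AE)
    qed
  qed
  moreover have "summable (\<lambda>j. norm (?e j))"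
    using f g sums_summable[OF sums_interleave[OF summable_sums summable_sums]]
    unfolding atomic_decomposition_def if_distrib[of norm] by blast
  moreover have "\<exists>I\<in>\<I>. atom_on I (?t j)" for j
    using f g unfolding atomic_decomposition_def by simp
  ultimately show ?thesis unfolding atomic_decomposition_iff by blast
qed

lemma atomic_decomposition_scale:
  fixes f :: "real \<Rightarrow> 'a::{real_normed_field,banach,second_countable_topology}"
  assumes "atomic_decomposition \<I> f c a"
  shows "atomic_decomposition \<I> (\<lambda>x. k * f x) (\<lambda>j. k * c j) a"
proof -
  have s: "integrable lebesgue (\<lambda>x. \<Sum>j<n. c j * a j x)" "integrable lebesgue f"
      "(\<lambda>n. LINT x|lebesgue. norm ((\<Sum>j<n. c j * a j x) - f x)) \<longlonglongrightarrow> 0" for n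
    using assms unfolding atomic_decomposition_def L1_limit_def by auto
  have k: "(\<Sum>j<n. k * c j * a j x) = k * (\<Sum>j<n. c j * a j x)" for n x
    by (simp add: sum_distrib_left mult.assoc)
  have "L1_limit (\<lambda>n x. \<Sum>j<n. k * c j * a j x) (\<lambda>x. k * f x)"
    unfolding L1_limit_def k
    using s tendsto_mult_right_zero[OF s(3), of "norm k"]
    by (simp add: right_diff_distrib[symmetric] norm_mult)
  then show ?thesis
    using assms unfolding atomic_decomposition_iff by (auto simp: norm_mult intro: summable_mult)
qed

lemma zero_in_atomic_space:
  assumes "I \<in> \<I>" "is_interval I" "bounded I" "0 < measure lebesgue I"
  shows "(\<lambda>x. 0) \<in> atomic_space \<I>"
proof -
  have "atom_on I (\<lambda>x. 0)"
    using assms by (simp add: atom_on_def)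
  then have "atomic_decomposition \<I> (\<lambda>x. 0) (\<lambda>j. 0) (\<lambda>j x. 0)"
    using assms(1) unfolding atomic_decomposition_iff L1_limit_def by auto
  then show ?thesis unfolding atomic_space_def by blast
qed

lemma subspace_H1_2s:
  "module.subspace function_scale
    (H1_2s :: (real \<Rightarrow> 'a::{real_normed_field,banach,second_countable_topology}) set)"
  unfolding module.subspace_def[OF module_function_scale]
proof (intro conjI ballI allI)
  have "(\<lambda>x. 0) \<in> (H1_2s :: (real \<Rightarrow> 'a) set)"
    unfolding H1_2s_def
    by (rule zero_in_atomic_space[of "{0..1}"]) (auto simp: one_sided_sets_def is_interval_cc)
  then show "0 \<in> (H1_2s :: (real \<Rightarrow> 'a) set)" by (simp add: zero_fun_def)
next
  fix f g :: "real \<Rightarrow> 'a" assume "f \<in> H1_2s" "g \<in> H1_2s"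
  then show "f + g \<in> H1_2s"
    unfolding H1_2s_def atomic_space_def plus_fun_def using atomic_decomposition_add by blast
next
  fix k and f :: "real \<Rightarrow> 'a" assume "f \<in> H1_2s"
  then show "function_scale k f \<in> H1_2s"
    unfolding H1_2s_def atomic_space_def function_scale_def
    using atomic_decomposition_scale by blast
qed

lemma H1_norm_le_H1_2s_norm:
  assumes "f \<in> H1_2s"
  shows "H1_norm f \<le> H1_2s_norm f"
  unfolding H1_norm_def H1_2s_norm_def atomic_norm_def
proof (rule cInf_superset_mono)
  show "{\<Sum>j. norm (c j) |c a. atomic_decomposition one_sided_sets f c a} \<noteq> {}"
    using assms unfolding H1_2s_def atomic_space_def by blast
  show "bdd_below {\<Sum>j. norm (c j) |c a. atomic_decomposition UNIV f c a}"
    by (rule bdd_belowI[of _ 0]) (auto simp: atomic_decomposition_def intro: suminf_nonneg)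
  show "{\<Sum>j. norm (c j) |c a. atomic_decomposition one_sided_sets f c a}
      \<subseteq> {\<Sum>j. norm (c j) |c a. atomic_decomposition UNIV f c a}"
    unfolding atomic_decomposition_def by blast
qed

lemma continuous_inclusion_H1_2s_H1:
  "continuous_map
    (norm_topology (H1_2s :: (real \<Rightarrow> 'a::{real_normed_field,banach,second_countable_topology}) set)
      H1_2s_norm)
    (norm_topology (H1 :: (real \<Rightarrow> 'a) set) H1_norm) (\<lambda>f. f)"
  unfolding continuous_map_def topspace_norm_topology openin_norm_topology
proof (intro conjI allI impI ballI)
  show "(\<lambda>f. f) \<in> (H1_2s :: (real \<Rightarrow> 'a) set) \<rightarrow> H1"
    using H1_2s_subset_H1 by blast
next
  fix U and f :: "real \<Rightarrow> 'a"
  assume U: "U \<subseteq> H1 \<and> (\<forall>f\<in>U. \<exists>e>0. \<forall>g\<in>H1. H1_norm (g - f) < e \<longrightarrow> g \<in> U)"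
    and f: "f \<in> {f \<in> H1_2s. f \<in> U}"
  then obtain e where e: "e > 0" "\<And>g. g \<in> H1 \<Longrightarrow> H1_norm (g - f) < e \<Longrightarrow> g \<in> U"
    by blast
  have "g \<in> U" if "g \<in> H1_2s" "H1_2s_norm (g - f) < e" for g
  proof -
    have "g - f \<in> H1_2s"
      using module.subspace_diff[OF module_function_scale subspace_H1_2s] that f by blast
    then have "H1_norm (g - f) < e"
      using H1_norm_le_H1_2s_norm[of "g - f"] that by linarith
    then show ?thesis using e(2) that(1) H1_2s_subset_H1 by blast
  qed
  then show "\<exists>e>0. \<forall>g\<in>H1_2s. H1_2s_norm (g - f) < e \<longrightarrow> g \<in> {f \<in> H1_2s. f \<in> U}"
    using e(1) by blast
qed auto


section \<open>Convergence of atomic series\<close>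

lemma integrable_indicator_interval:
  fixes p q :: real
  shows "integrable lebesgue (indicat_real {p..q})" "integrable lebesgue (indicat_real {p<..q})"
    "integrable lebesgue (indicat_real {p..<q})"
proof -
  have "{p..q} \<in> lmeasurable" "{p<..q} \<in> lmeasurable" "{p..<q} \<in> lmeasurable"
    by (auto intro!: bounded_set_imp_lmeasurable intro: bounded_subset[OF bounded_closed_interval[of p q]])
  then show "integrable lebesgue (indicat_real {p..q})" "integrable lebesgue (indicat_real {p<..q})"
    "integrable lebesgue (indicat_real {p..<q})"
    by (auto simp: fmeasurable_def)
qed

lemma atom_on_L1_norm:
  fixes a :: "real \<Rightarrow> 'a::{real_normed_field,banach,second_countable_topology}"
  assumes "atom_on I a"
  shows "(LINT x|lebesgue. norm (a x)) \<le> 1"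
proof -
  obtain p q where pq: "p \<le> q" "I \<subseteq> {p..q}" "q - p \<le> measure lebesgue I"
    using atom_on_hull[OF assms] by metis
  have m: "0 < measure lebesgue I" and b: "norm (a x) \<le> 1 / measure lebesgue I" for x
    using assms by (auto simp: atom_on_def)
  have "(LINT x|lebesgue. norm (a x))
      \<le> (LINT x|lebesgue. indicator {p..q} x * (1 / measure lebesgue I))"
  proof (rule integral_mono)
    show "integrable lebesgue (\<lambda>x. norm (a x))" using atom_on_integrable[OF assms] by simp
    show "integrable lebesgue (\<lambda>x. indicator {p..q} x * (1 / measure lebesgue I))"
      by (intro integrable_mult_left integrable_indicator_interval)
    show "norm (a x) \<le> indicator {p..q} x * (1 / measure lebesgue I)" for x
    proof (cases "x \<in> {p..q}")
      case False
      then have "a x = 0" using atom_on_support[OF assms] pq(2) by blast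
      then show ?thesis using False by simp
    qed (use b[of x] in simp)
  qed
  also have "\<dots> = (q - p) / measure lebesgue I" using pq by simp
  also have "\<dots> \<le> 1" using pq m by simp
  finally show ?thesis .
qed

lemma L1_limit_suminf:
  fixes u :: "nat \<Rightarrow> real \<Rightarrow> 'a::{real_normed_field,banach,second_countable_topology}"
  assumes u: "\<And>j. integrable lebesgue (u j)"
    and pt: "\<And>x. summable (\<lambda>j. norm (u j x))"
    and L1: "summable (\<lambda>j. LINT x|lebesgue. norm (u j x))"
  shows "L1_limit (\<lambda>n x. \<Sum>j<n. u j x) (\<lambda>x. \<Sum>j. u j x)"
  unfolding L1_limit_def
proof (intro conjI allI)
  show "integrable lebesgue (\<lambda>x. \<Sum>j<n. u j x)" for n using u by simp
  show f: "integrable lebesgue (\<lambda>x. \<Sum>j. u j x)"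
    by (intro integrable_suminf u L1) (use pt in simp)
  have w: "integrable lebesgue (\<lambda>x. \<Sum>j. norm (u j x))"
    by (intro integrable_suminf integrable_norm u) (use pt L1 in simp_all)
  have "(\<lambda>n. LINT x|lebesgue. norm ((\<Sum>j<n. u j x) - (\<Sum>j. u j x))) \<longlonglongrightarrow> (LINT x::real|lebesgue. 0::real)"
  proof (rule integral_dominated_convergence[OF _ _ w])
    show "(\<lambda>x. 0::real) \<in> borel_measurable lebesgue" by simp
    show "(\<lambda>x. norm ((\<Sum>j<n. u j x) - (\<Sum>j. u j x))) \<in> borel_measurable lebesgue" for n
      using u f by (intro borel_measurable_integrable) simp
    show "AE x in lebesgue. (\<lambda>n. norm ((\<Sum>j<n. u j x) - (\<Sum>j. u j x))) \<longlonglongrightarrow> 0"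
      using summable_LIMSEQ[OF summable_norm_cancel[OF pt]]
      by (simp add: LIM_zero tendsto_norm_zero)
    show "AE x in lebesgue. norm (norm ((\<Sum>j<n. u j x) - (\<Sum>j. u j x))) \<le> (\<Sum>j. norm (u j x))" for n
    proof (intro always_eventually allI)
      fix x
      have "norm ((\<Sum>j<n. u j x) - (\<Sum>j. u j x)) = norm (\<Sum>j. u (j + n) x)"
        using suminf_split_initial_segment[OF summable_norm_cancel[OF pt], of x n] by simp
      also have "\<dots> \<le> (\<Sum>j. norm (u (j + n) x))"
        by (intro summable_norm summable_ignore_initial_segment[OF pt])
      also have "\<dots> \<le> (\<Sum>j. norm (u j x))"
        using suminf_split_initial_segment[OF pt, of x n] by (simp add: sum_nonneg)
      finally show "norm (norm ((\<Sum>j<n. u j x) - (\<Sum>j. u j x))) \<le> (\<Sum>j. norm (u j x))" by simp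
    qed
  qed
  then show "(\<lambda>n. LINT x|lebesgue. norm ((\<Sum>j<n. u j x) - (\<Sum>j. u j x))) \<longlonglongrightarrow> 0" by simp
qed

lemma atomic_decomposition_suminf:
  fixes a :: "nat \<Rightarrow> real \<Rightarrow> 'a::{real_normed_field,banach,second_countable_topology}"
  assumes at: "\<And>j. I j \<in> \<I>" "\<And>j. atom_on (I j) (a j)"
    and c: "summable (\<lambda>j. norm (c j))"
    and pt: "\<And>x. summable (\<lambda>j. norm (c j * a j x))"
  shows "atomic_decomposition \<I> (\<lambda>x. \<Sum>j. c j * a j x) c a"
proof -
  have "summable (\<lambda>j. LINT x|lebesgue. norm (c j * a j x))"
  proof (rule summable_comparison_test'[OF c])
    show "norm (LINT x|lebesgue. norm (c j * a j x)) \<le> norm (c j)" for j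
      using mult_left_mono[OF atom_on_L1_norm[OF at(2)], of "norm (c j)" j]
      by (simp add: norm_mult integral_nonneg_AE)
  qed
  then have "L1_limit (\<lambda>n x. \<Sum>j<n. c j * a j x) (\<lambda>x. \<Sum>j. c j * a j x)"
    using atom_on_integrable[OF at(2)] pt by (intro L1_limit_suminf) simp_all
  then show ?thesis
    using at c unfolding atomic_decomposition_iff by blast
qed

section \<open>A regularized logarithm on the half line\<close>

text \<open>
  The mean oscillation of \<open>ln (x + \<epsilon>)\<close> over \<open>[p, q]\<close>, measured from the value at the right
  endpoint, is at most \<open>1\<close>, whatever the values of \<open>p \<ge> 0\<close> and \<open>\<epsilon> > 0\<close>.
\<close>

lemma log_oscillation:
  fixes \<epsilon> p q :: real
  assumes "0 < \<epsilon>" "0 \<le> p" "p \<le> q"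
  shows "integrable lebesgue (\<lambda>x. indicator {p..q} x * (ln (q + \<epsilon>) - ln (x + \<epsilon>)))"
    and "(LINT x|lebesgue. indicator {p..q} x * (ln (q + \<epsilon>) - ln (x + \<epsilon>))) \<le> q - p"
proof -
  define F where "F x = (x + \<epsilon>) * (ln (q + \<epsilon>) - ln (x + \<epsilon>) + 1)" for x
  have "has_bochner_integral lborel
      (\<lambda>x. (ln (q + \<epsilon>) - ln (x + \<epsilon>)) * indicator {p..q} x) (F q - F p)"
  proof (rule has_bochner_integral_FTC_Icc_real[OF assms(3)])
    fix x assume "p \<le> x"
    then have x: "0 < x + \<epsilon>" using assms by linarith
    show "DERIV F x :> ln (q + \<epsilon>) - ln (x + \<epsilon>)"
      unfolding F_def using x by (auto intro!: derivative_eq_intros)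
    show "isCont (\<lambda>x. ln (q + \<epsilon>) - ln (x + \<epsilon>)) x"
      using x by (intro continuous_intros) auto
  qed
  then have *: "has_bochner_integral lborel
      (\<lambda>x. indicator {p..q} x * (ln (q + \<epsilon>) - ln (x + \<epsilon>))) (F q - F p)"
    by (simp add: mult.commute)
  have meas: "(\<lambda>x. indicator {p..q} x * (ln (q + \<epsilon>) - ln (x + \<epsilon>))) \<in> borel_measurable lborel"
    by measurable
  show "integrable lebesgue (\<lambda>x. indicator {p..q} x * (ln (q + \<epsilon>) - ln (x + \<epsilon>)))"
    using * by (subst integrable_completion[OF meas]) (auto simp: has_bochner_integral_iff)
  have "(LINT x|lebesgue. indicator {p..q} x * (ln (q + \<epsilon>) - ln (x + \<epsilon>))) = F q - F p"
    using * by (subst integral_completion[OF meas]) (auto simp: has_bochner_integral_iff)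
  also have "\<dots> \<le> q - p"
  proof -
    have "ln (p + \<epsilon>) \<le> ln (q + \<epsilon>)" using assms by simp
    then have "0 \<le> (p + \<epsilon>) * (ln (q + \<epsilon>) - ln (p + \<epsilon>))" using assms by simp
    then show ?thesis unfolding F_def by (simp add: algebra_simps)
  qed
  finally show "(LINT x|lebesgue. indicator {p..q} x * (ln (q + \<epsilon>) - ln (x + \<epsilon>))) \<le> q - p" .
qed

text \<open>
  The logarithm on the right half line, made bounded: \<open>\<epsilon>\<close> removes the singularity at \<open>0\<close>, and
  subtracting \<open>ln (x + 1)\<close> the growth at infinity.  For \<open>\<epsilon> \<le> 1\<close> it is increasing on
  \<open>[0, \<infinity>)\<close>.
\<close>

definition log_weight :: "real \<Rightarrow> real \<Rightarrow> real"
  where "log_weight \<epsilon> x = (if 0 \<le> x then ln (x + \<epsilon>) - ln (x + 1) else 0)"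

lemma log_weight_measurable: "log_weight \<epsilon> \<in> borel_measurable lebesgue"
  unfolding log_weight_def[abs_def] by (rule measurable_completion) measurable

lemma log_weight_diff:
  assumes "0 < \<epsilon>" "\<epsilon> \<le> 1" "0 \<le> x" "x \<le> y"
  shows "0 \<le> log_weight \<epsilon> y - log_weight \<epsilon> x"
    and "log_weight \<epsilon> y - log_weight \<epsilon> x \<le> ln (y + \<epsilon>) - ln (x + \<epsilon>)"
proof -
  have "(x + \<epsilon>) * (y + 1) \<le> (y + \<epsilon>) * (x + 1)"
    using mult_nonneg_nonneg[of "y - x" "1 - \<epsilon>"] assms by (simp add: algebra_simps)
  then have "ln ((x + \<epsilon>) * (y + 1)) \<le> ln ((y + \<epsilon>) * (x + 1))"
    using assms by (intro ln_mono) auto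
  then show "0 \<le> log_weight \<epsilon> y - log_weight \<epsilon> x"
    using assms by (simp add: log_weight_def ln_mult)
  have "ln (x + 1) \<le> ln (y + 1)" using assms by simp
  then show "log_weight \<epsilon> y - log_weight \<epsilon> x \<le> ln (y + \<epsilon>) - ln (x + \<epsilon>)"
    using assms by (simp add: log_weight_def)
qed

lemma log_weight_bounded:
  assumes "0 < \<epsilon>" "\<epsilon> \<le> 1"
  shows "\<bar>log_weight \<epsilon> x\<bar> \<le> - ln \<epsilon>"
proof (cases "0 \<le> x")
  case True
  have "ln (x + \<epsilon>) \<le> ln (x + 1)" using True assms by simp
  then have "log_weight \<epsilon> x \<le> 0" using True by (simp add: log_weight_def)
  moreover have "log_weight \<epsilon> 0 \<le> log_weight \<epsilon> x" using log_weight_diff(1)[of \<epsilon> 0 x] assms True by simp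
  ultimately show ?thesis by (simp add: log_weight_def)
next
  case False
  have "ln \<epsilon> \<le> 0" using assms by simp
  then show ?thesis using False by (simp add: log_weight_def)
qed

text \<open>
  An atom supported on the right half line has mean zero, so the weight may be replaced by its
  difference from its value at the right endpoint, and the oscillation bound applies.
\<close>

lemma log_weight_one_sided_atom:
  fixes a :: "real \<Rightarrow> 'a::{real_normed_field,banach,second_countable_topology}"
  assumes a: "atom_on I a" and I: "I \<in> one_sided_sets" and \<epsilon>: "0 < \<epsilon>" "\<epsilon> \<le> 1"
  shows "norm (LINT x|lebesgue. log_weight \<epsilon> x *\<^sub>R a x) \<le> 1"
proof (cases "I \<subseteq> {..0}")
  case True
  then show ?thesis by (subst atom_on_left_half_line[OF a]) (auto simp: log_weight_def)
next
  case False
  then have "I \<subseteq> {0..}" using I by (auto simp: one_sided_sets_def)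
  with atom_on_hull[OF a] obtain p q where pq:
    "p \<le> q" "I \<subseteq> {p..q}" "q - p \<le> measure lebesgue I" "0 \<le> p" by metis
  define m where "m = measure lebesgue I"
  have m: "0 < m" and b: "norm (a x) \<le> 1 / m" for x
    using a by (auto simp: atom_on_def m_def)
  note ai = atom_on_integrable[OF a]
  note wi = integrable_bounded_scaleR[OF ai log_weight_measurable log_weight_bounded[OF \<epsilon>]]
  have "(LINT x|lebesgue. log_weight \<epsilon> x *\<^sub>R a x)
      = (LINT x|lebesgue. log_weight \<epsilon> x *\<^sub>R a x - log_weight \<epsilon> q *\<^sub>R a x)"
    using wi ai atom_on_integral[OF a] by simp
  also have "norm \<dots>
      \<le> (LINT x|lebesgue. indicator {p..q} x * (ln (q + \<epsilon>) - ln (x + \<epsilon>)) * (1 / m))"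
  proof (rule Bochner_Integration.integral_norm_bound_integral)
    show "integrable lebesgue (\<lambda>x. log_weight \<epsilon> x *\<^sub>R a x - log_weight \<epsilon> q *\<^sub>R a x)"
      using wi ai by simp
    show "integrable lebesgue (\<lambda>x. indicator {p..q} x * (ln (q + \<epsilon>) - ln (x + \<epsilon>)) * (1 / m))"
      using log_oscillation(1)[OF \<epsilon>(1) pq(4,1)] by (rule integrable_mult_left)
    show "norm (log_weight \<epsilon> x *\<^sub>R a x - log_weight \<epsilon> q *\<^sub>R a x)
        \<le> indicator {p..q} x * (ln (q + \<epsilon>) - ln (x + \<epsilon>)) * (1 / m)" for x
    proof (cases "x \<in> {p..q}")
      case True
      then have "\<bar>log_weight \<epsilon> x - log_weight \<epsilon> q\<bar> \<le> ln (q + \<epsilon>) - ln (x + \<epsilon>)"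
        using log_weight_diff[OF \<epsilon>, of x q] pq(4) by auto
      then have "\<bar>log_weight \<epsilon> x - log_weight \<epsilon> q\<bar> * norm (a x)
          \<le> (ln (q + \<epsilon>) - ln (x + \<epsilon>)) * (1 / m)"
        using b by (intro mult_mono) auto
      then show ?thesis using True by (simp add: scaleR_diff_left[symmetric])
    next
      case False
      then have "a x = 0" using atom_on_support[OF a] pq(2) by blast
      then show ?thesis using False by simp
    qed
  qed
  also have "\<dots> = (LINT x|lebesgue. indicator {p..q} x * (ln (q + \<epsilon>) - ln (x + \<epsilon>))) * (1 / m)"
    by (rule integral_mult_left_zero)
  also have "\<dots> \<le> m * (1 / m)"
    using log_oscillation(2)[OF \<epsilon>(1) pq(4,1)] pq(3) m unfolding m_def[symmetric]
    by (intro mult_right_mono) auto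
  finally show ?thesis using m by simp
qed

lemma H1_2s_log_weight_bounded:
  fixes f :: "real \<Rightarrow> 'a::{real_normed_field,banach,second_countable_topology}"
  assumes "f \<in> H1_2s"
  obtains K where "\<And>\<epsilon>. 0 < \<epsilon> \<Longrightarrow> \<epsilon> \<le> 1 \<Longrightarrow> norm (LINT x|lebesgue. log_weight \<epsilon> x *\<^sub>R f x) \<le> K"
proof -
  obtain c a where ca: "atomic_decomposition one_sided_sets f c a"
    using assms by (auto simp: H1_2s_def atomic_space_def)
  then have c: "summable (\<lambda>j. norm (c j))" by (simp add: atomic_decomposition_def)
  have "norm (LINT x|lebesgue. log_weight \<epsilon> x *\<^sub>R f x) \<le> (\<Sum>j. norm (c j))"
    if \<epsilon>: "0 < \<epsilon>" "\<epsilon> \<le> 1" for \<epsilon>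
  proof -
    let ?t = "\<lambda>j. c j * (LINT x|lebesgue. log_weight \<epsilon> x *\<^sub>R a j x)"
    have sums: "?t sums (LINT x|lebesgue. log_weight \<epsilon> x *\<^sub>R f x)"
      by (rule decomposition_weighted_sums[OF ca log_weight_measurable log_weight_bounded[OF \<epsilon>]])
    have le: "norm (?t j) \<le> norm (c j)" for j
    proof -
      obtain I where "I \<in> one_sided_sets" "atom_on I (a j)"
        using ca by (auto simp: atomic_decomposition_def)
      then have "norm (LINT x|lebesgue. log_weight \<epsilon> x *\<^sub>R a j x) \<le> 1"
        using log_weight_one_sided_atom \<epsilon> by blast
      then show ?thesis unfolding norm_mult by (rule mult_left_le) simp
    qed
    have "norm (\<Sum>j. ?t j) \<le> (\<Sum>j. norm (c j))"
      by (rule norm_suminf_le[OF le c])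
    then show ?thesis using sums by (simp add: sums_iff)
  qed
  then show ?thesis using that by blast
qed

section \<open>A function with divergent logarithmic integral\<close>

text \<open>
  The real-valued function \<open>sgn x / (2 h)\<close> on \<open>[-h, h]\<close>, extended by \<open>0\<close>.  It is an atom whose
  defining interval contains the origin in its interior.
\<close>

definition odd_atom :: "real \<Rightarrow> real \<Rightarrow> real"
  where "odd_atom h x = (indicator {0<..h} x - indicator {-h..<0} x) / (2 * h)"

lemma atom_on_odd_atom:
  assumes "0 < h"
  shows "atom_on {-h..h}
    (\<lambda>x. of_real (odd_atom h x) :: 'a::{real_normed_field,banach,second_countable_topology})"
proof -
  let ?a = "\<lambda>x. of_real (odd_atom h x) :: 'a"
  have ints: "integrable lebesgue (indicat_real {0<..h})" "integrable lebesgue (indicat_real {-h..<0})"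
    by (auto intro: integrable_indicator_interval)
  have supp: "x \<in> {-h..h}" if "?a x \<noteq> 0" for x
    using that assms by (auto simp: odd_atom_def split: split_indicator_asm)
  have "closure {x. ?a x \<noteq> 0} \<subseteq> {-h..h}"
    by (rule closure_minimal) (use supp in auto)
  moreover have "(LINT x:{-h..h}|lebesgue. ?a x) = 0"
  proof -
    have "(LINT x:{-h..h}|lebesgue. ?a x) = (LINT x|lebesgue. ?a x)"
      unfolding set_lebesgue_integral_def
      by (intro Bochner_Integration.integral_cong) (use supp in \<open>auto simp: indicator_def\<close>)
    also have "\<dots> = of_real (LINT x|lebesgue. odd_atom h x)"
      using ints by (intro integral_of_real) (simp add: odd_atom_def)
    also have "(LINT x|lebesgue. odd_atom h x) = 0"
      unfolding odd_atom_def using assms ints by simp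
    finally show ?thesis by simp
  qed
  moreover have "?a \<in> borel_measurable lebesgue"
    unfolding odd_atom_def by (intro measurable_completion) measurable
  moreover have "norm (?a x) \<le> 1 / measure lebesgue {-h..h}" for x
    using assms unfolding norm_of_real by (auto simp: odd_atom_def indicator_def)
  ultimately show ?thesis
    unfolding atom_on_def using assms by (simp add: is_interval_cc)
qed

lemma odd_atom_weighted:
  assumes g: "g \<in> borel_measurable lebesgue" "\<And>x. \<bar>g x\<bar> \<le> B" "\<And>x. x < 0 \<Longrightarrow> g x = 0"
  shows "(LINT x|lebesgue. g x *\<^sub>R (of_real (odd_atom h x)
        :: 'a::{real_normed_field,banach,second_countable_topology}))
      = of_real ((LINT x|lebesgue. indicator {0<..h} x * g x) / (2 * h))"
proof -
  have int: "integrable lebesgue (\<lambda>x. indicator {0<..h} x * g x / (2 * h))"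
    using integrable_bounded_scaleR[OF integrable_indicator_interval(2) g(1,2)]
    by (simp add: mult.commute)
  have "(LINT x|lebesgue. g x *\<^sub>R (of_real (odd_atom h x) :: 'a))
      = (LINT x|lebesgue. of_real (indicator {0<..h} x * g x / (2 * h)))"
    by (intro Bochner_Integration.integral_cong)
       (auto simp: odd_atom_def indicator_def g(3) scaleR_conv_of_real)
  also have "\<dots> = of_real (LINT x|lebesgue. indicator {0<..h} x * g x / (2 * h))"
    by (rule integral_of_real[OF int])
  finally show ?thesis by simp
qed

text \<open>
  On \<open>(0, h]\<close> the weight lies below its value at \<open>h\<close>, by monotonicity, and its mean lies at most
  \<open>1\<close> below that value, by the oscillation bound.
\<close>

lemma log_weight_mean:
  assumes h: "0 < h" and \<epsilon>: "0 < \<epsilon>" "\<epsilon> \<le> 1"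
  shows "(LINT x|lebesgue. indicator {0<..h} x * log_weight \<epsilon> x) / (2 * h) \<le> log_weight \<epsilon> h / 2"
    and "(log_weight \<epsilon> h - 1) / 2 \<le> (LINT x|lebesgue. indicator {0<..h} x * log_weight \<epsilon> x) / (2 * h)"
proof -
  let ?J = "LINT x|lebesgue. indicator {0<..h} x * log_weight \<epsilon> x"
  have i: "integrable lebesgue (\<lambda>x. indicator {0<..h} x * log_weight \<epsilon> x)"
    using integrable_bounded_scaleR[OF integrable_indicator_interval(2) log_weight_measurable log_weight_bounded[OF \<epsilon>]]
    by (simp add: mult.commute)
  have ih: "integrable lebesgue (\<lambda>x. indicator {0<..h} x * log_weight \<epsilon> h)"
    by (intro integrable_mult_left integrable_indicator_interval)
  have int: "(LINT x|lebesgue. indicator {0<..h} x * log_weight \<epsilon> h) = h * log_weight \<epsilon> h"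
    using h by simp
  have "?J \<le> (LINT x|lebesgue. indicator {0<..h} x * log_weight \<epsilon> h)"
    using log_weight_diff(1)[OF \<epsilon>] i ih
    by (intro integral_mono) (auto simp: indicator_def)
  then show "?J / (2 * h) \<le> log_weight \<epsilon> h / 2"
    using h unfolding int by (simp add: field_simps)
  note osc = log_oscillation[OF \<epsilon>(1) order_refl less_imp_le[OF h]]
  have "(LINT x|lebesgue. indicator {0<..h} x * log_weight \<epsilon> h) - ?J
      = (LINT x|lebesgue. indicator {0<..h} x * log_weight \<epsilon> h - indicator {0<..h} x * log_weight \<epsilon> x)"
    by (rule Bochner_Integration.integral_diff[symmetric, OF ih i])
  also have "\<dots> \<le> (LINT x|lebesgue. indicator {0..h} x * (ln (h + \<epsilon>) - ln (x + \<epsilon>)))"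
    using i ih osc(1) log_weight_diff(2)[OF \<epsilon>] \<epsilon>
    by (intro integral_mono) (auto simp: indicator_def)
  finally have "h * log_weight \<epsilon> h - ?J \<le> h" using osc(2) unfolding int by linarith
  then show "(log_weight \<epsilon> h - 1) / 2 \<le> ?J / (2 * h)"
    using h by (simp add: field_simps)
qed

text \<open>
  The widths decrease so fast that \<open>ln (2 * lacunary_width j) = - (2 ^ j)\<close> cancels the decay of the
  coefficients \<open>(1/2) ^ j\<close>.
\<close>

definition lacunary_width :: "nat \<Rightarrow> real"
  where "lacunary_width j = exp (- (2 ^ j)) / 2"

text \<open>
  The coefficient of index \<open>0\<close> makes the total sum zero, as required for membership in
  \<open>HA\<close>.
\<close>

definition lacunary_coeff :: "nat \<Rightarrow> real"
  where "lacunary_coeff j = (if j = 0 then -1 else (1/2) ^ j)"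

text \<open>
  The sum of the atomic series.  At each point only finitely many terms are nonzero, so that the
  pointwise sum is meaningful everywhere.
\<close>

definition lacunary_function :: "real \<Rightarrow> 'a::{real_normed_field,banach,second_countable_topology}"
  where "lacunary_function x = (\<Sum>j. of_real (lacunary_coeff j) * of_real (odd_atom (lacunary_width j) x))"

lemma lacunary_width_pos: "0 < lacunary_width j"
  by (simp add: lacunary_width_def)

lemma lacunary_width_le_1: "lacunary_width j \<le> 1"
proof -
  have "exp (- (2 ^ j)) \<le> (1::real)" by simp
  then show ?thesis unfolding lacunary_width_def by linarith
qed

lemma lacunary_width_antimono: "i \<le> j \<Longrightarrow> lacunary_width j \<le> lacunary_width i"
  by (simp add: lacunary_width_def)

lemma lacunary_coeff_sums: "lacunary_coeff sums 0"
proof -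
  have "(\<lambda>j. lacunary_coeff (Suc j)) sums 1"
    unfolding lacunary_coeff_def using power_half_series by simp
  then show ?thesis using sums_Suc[of lacunary_coeff 1] by (simp add: lacunary_coeff_def)
qed

lemma lacunary_coeff_summable: "summable (\<lambda>j. \<bar>lacunary_coeff j\<bar>)"
proof (rule summable_comparison_test')
  show "summable (\<lambda>j. (1/2::real) ^ j)" by (rule summable_geometric) simp
  show "norm \<bar>lacunary_coeff j\<bar> \<le> (1/2) ^ j" for j by (simp add: lacunary_coeff_def)
qed

lemma odd_atom_lacunary_width_eventually_0:
  "\<exists>N. \<forall>j\<ge>N. odd_atom (lacunary_width j) x = 0"
proof (cases "x = 0")
  case False
  obtain N where N: "1 / \<bar>x\<bar> < 2 ^ N"
    using real_arch_pow[of 2 "1 / \<bar>x\<bar>"] by auto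
  have "odd_atom (lacunary_width j) x = 0" if "N \<le> j" for j
  proof -
    have "(2::real) ^ N \<le> 2 ^ j" using that by simp
    also have "\<dots> \<le> exp (2 ^ j)" using exp_ge_add_one_self[of "2 ^ j"] by linarith
    finally have "1 / \<bar>x\<bar> < exp (2 ^ j)" using N by linarith
    then have "exp (- (2 ^ j)) < \<bar>x\<bar>" using False by (simp add: exp_minus field_simps)
    then have "lacunary_width j < \<bar>x\<bar>"
      unfolding lacunary_width_def using exp_gt_zero[of "- (2 ^ j)"] by linarith
    then show ?thesis by (auto simp: odd_atom_def indicator_def)
  qed
  then show ?thesis by blast
qed (simp add: odd_atom_def)

lemma lacunary_function_decomposition:
  "atomic_decomposition UNIV
    (lacunary_function :: real \<Rightarrow> 'a::{real_normed_field,banach,second_countable_topology})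
    (\<lambda>j. of_real (lacunary_coeff j)) (\<lambda>j x. of_real (odd_atom (lacunary_width j) x))"
  unfolding lacunary_function_def[abs_def]
proof (rule atomic_decomposition_suminf)
  show "atom_on {- lacunary_width j..lacunary_width j}
      (\<lambda>x. of_real (odd_atom (lacunary_width j) x) :: 'a)" for j
    by (rule atom_on_odd_atom[OF lacunary_width_pos])
  show "summable (\<lambda>j. norm (of_real (lacunary_coeff j) :: 'a))"
    using lacunary_coeff_summable by simp
  fix x
  obtain N where "\<And>j. N \<le> j \<Longrightarrow> odd_atom (lacunary_width j) x = 0"
    using odd_atom_lacunary_width_eventually_0 by blast
  then show "summable (\<lambda>j. norm (of_real (lacunary_coeff j)
      * of_real (odd_atom (lacunary_width j) x) :: 'a))"
    by (intro summable_finite[of "{..<N}"]) (auto simp: not_less)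
qed auto

lemma lacunary_function_weighted_sums:
  assumes g: "g \<in> borel_measurable lebesgue" "\<And>x. \<bar>g x\<bar> \<le> B" "\<And>x. x < 0 \<Longrightarrow> g x = 0"
  shows "(\<lambda>j. of_real (lacunary_coeff j *
        ((LINT x|lebesgue. indicator {0<..lacunary_width j} x * g x) / (2 * lacunary_width j))))
    sums (LINT x|lebesgue. g x *\<^sub>R
      (lacunary_function x :: 'a::{real_normed_field,banach,second_countable_topology}))"
  using decomposition_weighted_sums[OF lacunary_function_decomposition g(1,2)]
  by (simp only: odd_atom_weighted[OF g] of_real_mult)

lemma lacunary_function_in_HA:
  "(lacunary_function :: real \<Rightarrow> 'a::{real_normed_field,banach,second_countable_topology}) \<in> HA"
proof -
  have mean: "(LINT x|lebesgue. indicator {0<..lacunary_width j} x * indicat_real {0..} x)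
      / (2 * lacunary_width j) = 1 / 2" for j
  proof -
    have "(LINT x|lebesgue. indicator {0<..lacunary_width j} x * indicat_real {0..} x)
        = (LINT x|lebesgue. indicator {0<..lacunary_width j} x)"
      by (intro Bochner_Integration.integral_cong) (auto simp: indicator_def)
    then show ?thesis using lacunary_width_pos[of j] by simp
  qed
  have "(\<lambda>j. of_real (lacunary_coeff j * (1 / 2)) :: 'a)
      sums (LINT x|lebesgue. indicat_real {0..} x *\<^sub>R lacunary_function x)"
    using lacunary_function_weighted_sums[OF indicator_half_line_measurable, of 1, where ?'a='a]
    unfolding mean by simp
  moreover have "(\<lambda>j. of_real (lacunary_coeff j * (1 / 2)) :: 'a) sums of_real (0 * (1 / 2))"
    by (intro sums_of_real sums_mult2 lacunary_coeff_sums)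
  ultimately have "(LINT x|lebesgue. indicat_real {0..} x *\<^sub>R (lacunary_function x :: 'a)) = 0"
    using sums_unique2 by fastforce
  then show ?thesis
    using lacunary_function_decomposition
    unfolding HA_def H1_def atomic_space_def set_lebesgue_integral_def by blast
qed

lemma lacunary_function_log_weight_lower_bound:
  "n / 2 - (1 + ln (lacunary_width 0 + 1) - ln (lacunary_width 0)) / 2
    \<le> norm (LINT x|lebesgue. log_weight (lacunary_width n) x *\<^sub>R
        (lacunary_function x :: 'a::{real_normed_field,banach,second_countable_topology}))"
proof -
  define \<epsilon> where "\<epsilon> = lacunary_width n"
  define K where "K = (1 + ln (lacunary_width 0 + 1) - ln (lacunary_width 0)) / 2"
  define r where "r j = lacunary_coeff j * ((LINT x|lebesgue.
    indicator {0<..lacunary_width j} x * log_weight \<epsilon> x) / (2 * lacunary_width j))" for j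
  have \<epsilon>: "0 < \<epsilon>" "\<epsilon> \<le> 1"
    using lacunary_width_pos lacunary_width_le_1 by (auto simp: \<epsilon>_def)
  note mean = log_weight_mean[OF lacunary_width_pos \<epsilon>]
  \<comment> \<open>The negative coefficient needs the lower bound for the mean, all others the upper bound.\<close>
  have r0: "r 0 \<le> K"
  proof -
    have "ln (lacunary_width 0) \<le> ln (lacunary_width 0 + \<epsilon>)"
      using lacunary_width_pos[of 0] \<epsilon> by simp
    moreover have "r 0 \<le> - ((log_weight \<epsilon> (lacunary_width 0) - 1) / 2)"
      using mean(2)[of 0] by (simp only: r_def lacunary_coeff_def) simp
    moreover have "log_weight \<epsilon> (lacunary_width 0)
        = ln (lacunary_width 0 + \<epsilon>) - ln (lacunary_width 0 + 1)"
      using lacunary_width_pos[of 0] by (simp add: log_weight_def)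
    ultimately show ?thesis unfolding K_def by argo
  qed
  have r_le: "r j \<le> (1/2) ^ j * (log_weight \<epsilon> (lacunary_width j) / 2)" if "j \<noteq> 0" for j
    using mult_left_mono[OF mean(1)[of j], of "(1/2) ^ j"] that
    by (simp only: r_def lacunary_coeff_def) simp
  have r1: "r j \<le> - (1/2)" if "j \<noteq> 0" "j \<le> n" for j
  proof -
    have "lacunary_width j + \<epsilon> \<le> 2 * lacunary_width j"
      using lacunary_width_antimono[OF that(2)] by (simp add: \<epsilon>_def)
    also have "\<dots> = exp (- (2 ^ j))" by (simp add: lacunary_width_def)
    finally have "lacunary_width j + \<epsilon> \<le> exp (- (2 ^ j))" .
    then have "ln (lacunary_width j + \<epsilon>) \<le> - (2 ^ j)"
      using ln_mono[of "lacunary_width j + \<epsilon>" "exp (- (2 ^ j))"] lacunary_width_pos[of j] \<epsilon> by simp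
    moreover have "0 \<le> ln (lacunary_width j + 1)" using lacunary_width_pos[of j] by simp
    moreover have "log_weight \<epsilon> (lacunary_width j)
        = ln (lacunary_width j + \<epsilon>) - ln (lacunary_width j + 1)"
      using lacunary_width_pos[of j] by (simp add: log_weight_def)
    ultimately have "log_weight \<epsilon> (lacunary_width j) \<le> - (2 ^ j)" by linarith
    then have "(1/2) ^ j * (log_weight \<epsilon> (lacunary_width j) / 2) \<le> (1/2) ^ j * (- (2 ^ j) / 2)"
      by (intro mult_left_mono) auto
    also have "\<dots> = - (1/2)" by (simp add: power_one_over)
    finally show ?thesis using r_le[OF that(1)] by linarith
  qed
  have r2: "r j \<le> 0" if "j \<noteq> 0" for j
  proof -
    have "ln (lacunary_width j + \<epsilon>) \<le> ln (lacunary_width j + 1)"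
      using lacunary_width_pos[of j] \<epsilon> by simp
    then have "log_weight \<epsilon> (lacunary_width j) \<le> 0" by (simp add: log_weight_def)
    then have "(1/2) ^ j * (log_weight \<epsilon> (lacunary_width j) / 2) \<le> 0"
      by (simp add: mult_nonneg_nonpos)
    then show ?thesis using r_le[OF that] by linarith
  qed
  have first: "k \<le> n \<Longrightarrow> (\<Sum>j<Suc k. r j) \<le> K - k / 2" for k
  proof (induction k)
    case (Suc k)
    then show ?case using r1[of "Suc k"] by (simp add: field_simps)
  qed (use r0 in simp)
  have all: "(\<Sum>j<m. r j) \<le> K - n / 2" if "Suc n \<le> m" for m
    using that
  proof (induction m rule: nat_induct_at_least)
    case (Suc m)
    then show ?case using r2[of m] by simp
  qed (rule first[OF order_refl])
  have lim: "(\<lambda>m. norm (\<Sum>j<m. of_real (r j) :: 'a)) \<longlonglongrightarrow>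
      norm (LINT x|lebesgue. log_weight \<epsilon> x *\<^sub>R (lacunary_function x :: 'a))"
    using lacunary_function_weighted_sums[OF log_weight_measurable log_weight_bounded[OF \<epsilon>], where ?'a='a]
    unfolding r_def[symmetric] sums_def by (intro tendsto_norm) (simp add: log_weight_def)
  have "n / 2 - K \<le> norm (\<Sum>j<m. of_real (r j) :: 'a)" if "Suc n \<le> m" for m
  proof -
    have "norm (\<Sum>j<m. of_real (r j) :: 'a) = \<bar>\<Sum>j<m. r j\<bar>"
      by (simp flip: of_real_sum)
    then show ?thesis using all[OF that] by linarith
  qed
  then show ?thesis
    unfolding \<epsilon>_def[symmetric] K_def[symmetric]
    by (intro LIMSEQ_le_const[OF lim]) blast
qed

lemma lacunary_function_notin_H1_2s:
  "(lacunary_function :: real \<Rightarrow> 'a::{real_normed_field,banach,second_countable_topology}) \<notin> H1_2s"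
proof
  assume "(lacunary_function :: real \<Rightarrow> 'a) \<in> H1_2s"
  then obtain K where K: "\<And>\<epsilon>. 0 < \<epsilon> \<Longrightarrow> \<epsilon> \<le> 1 \<Longrightarrow>
      norm (LINT x|lebesgue. log_weight \<epsilon> x *\<^sub>R (lacunary_function x :: 'a)) \<le> K"
    using H1_2s_log_weight_bounded by metis
  define L where "L = (1 + ln (lacunary_width 0 + 1) - ln (lacunary_width 0)) / 2"
  have bound: "real n \<le> 2 * (K + L)" for n
  proof -
    have "norm (LINT x|lebesgue. log_weight (lacunary_width n) x *\<^sub>R (lacunary_function x :: 'a)) \<le> K"
      by (rule K[OF lacunary_width_pos lacunary_width_le_1])
    then show ?thesis
      using lacunary_function_log_weight_lower_bound[of n, where ?'a='a] unfolding L_def[symmetric] by argo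
  qed
  obtain n where "2 * (K + L) < real n" using reals_Archimedean2 by blast
  then show False using bound[of n] by linarith
qed

theorem mainTheorem9:
  shows "module.subspace function_scale
           (H1_2s :: (real \<Rightarrow> 'a::{real_normed_field,banach,second_countable_topology}) set) \<and>
         (H1_2s :: (real \<Rightarrow> 'a) set) \<subseteq> HA \<and>
         continuous_map (norm_topology (H1_2s :: (real \<Rightarrow> 'a) set) H1_2s_norm)
                        (norm_topology (H1 :: (real \<Rightarrow> 'a) set) H1_norm) (\<lambda>f. f) \<and>
         (\<exists>f::real \<Rightarrow> 'a. f \<in> HA \<and> f \<notin> H1_2s)"
  using subspace_H1_2s H1_2s_subset_HA continuous_inclusion_H1_2s_H1
    lacunary_function_in_HA lacunary_function_notin_H1_2s by blast

end
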